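(* Let $\mathcal{E}_1=(E_1;+_1,q_1,d_1,0_1,1_1)$ and $\mathcal{E}_2=(E_2;+_2,q_2,d_2,0_2,1_2)$ be q-effect algebras, and let $f:E_1\to E_2$ and $g:E_2\to E_1$ be mappings such that $(f,g)$ is a Galois q-connection. Let $\mathcal{E}_2$ be q-representable and let $\mathcal{E}_1$ be q-Jauch-Piron representable. Let $T$ be the set of all q-states on $\mathcal{E}_2$ and $S$ the set of all Jauch-Piron q-states on $\mathcal{E}_1$. Define $R_g\subseteq S\times T$ by $$sR_gt \iff s(g(x))\leq t(x)\ \text{for all } x\in E_2 .$$ Then $g$ is representable via the canonical Galois connection $(P^*,G^* )$ between $[0,1]^S$ and $[0,1]^T$ induced by the frame $(S,T,R_g)$ and the standard q-effect algebra, $G^*:[0,1]^T\to[0,1]^S$; that is, $i_{E_1}^S\circ g=G^*\circ i_{E_2}^T$, where $i_{E_2}^T:E_2\to[0,1]^T$, $x\mapsto (t(x))_{t\in T}$, and $i_{E_1}^S:E_1\to[0,1]^S$, $y\mapsto(s(y))_{s\in S}$.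
   Context: An effect algebra is a structure $(E;+,0,1)$ with distinguished elements $0\neq 1$ of $E$ and a partial binary operation $+$ such that for $x,y,z\in E$: (E1) if $x+y$ is defined then $y+x$ is defined and $x+y=y+x$; (E2) if $y+z$ and $x+(y+z)$ are defined then $x+y$ and $(x+y)+z$ are defined and $(x+y)+z=x+(y+z)$; (E3) for each $x$ there is a unique $x'\in E$ with $x+x'=1$; (E4) if $x+1$ is defined then $x=0$. The induced order is $x\leq y$ iff $x+z=y$ for some $z\in E$; it is a partial order with bottom $0$ and top $1$, and $x+y$ is defined iff $x\leq y'$. The dual partial operation: $x\cdot y$ is defined iff $x'\leq y$, and then $x\cdot y=(x'+y')'$. A q-effect algebra $(E;+,q,d,0,1)$ is an effect algebra with maps $q,d:E\to E$ such that for all $x,y,z\in E$: (Q1) $d(x')=q(x)'$; (Q2) $d(0)=0=q(0)$; (Q3) $d$ is order-preserving; (Q4) $x'\leq x$ implies $x\cdot x=d(x)$; (Q5) $z\leq x$, $z\leq y$ and $y'\leq x$ imply $d(z)\leq x\cdot y$. A pair $(f,g)$, $f:E_1\to E_2$, $g:E_2\to E_1$, is a Galois connection if $f(a)\leq b\iff a\leq g(b)$ for all $a\in E_1,b\in E_2$. It is a Galois q-connection if moreover $f(q_1(x))=q_2(f(x))$, $f(d_1(x))=d_2(f(x))$, $g(q_2(y))=q_1(g(y))$, $g(d_2(y))=d_1(g(y))$ for all $x\in E_1$, $y\in E_2$. On $[0,1]$ put $a\oplus b=\min(1,a+b)$ and $a\odot b=\max(0,a+b-1)$. The standard q-effect algebra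 is $[0,1]$ with $a+b$ defined iff the usual sum is $\leq 1$, $q(a)=a\oplus a$, $d(a)=a\odot a$; powers of it carry componentwise operations. A q-state on $\mathcal{E}$ is a map $s:E\to[0,1]$ with $s(0)=0$, $s(1)=1$, $s(x+y)=s(x)+s(y)$ whenever $x+y$ is defined, $s(q(x))=s(x)\oplus s(x)$ and $s(d(x))=s(x)\odot s(x)$ for all $x$. A q-state $s$ is Jauch-Piron if $s(x)=1=s(y)$ implies $s(z)=1$ for some $z\in E$ with $z\leq x$ and $z\leq y$. A set $S$ of q-states on $\mathcal{E}$ is order reflecting if for all $a,b\in E$: ($s(a)\leq s(b)$ for all $s\in S$) implies $a\leq b$. $\mathcal{E}$ is q-representable if it has an order reflecting set of q-states, and q-Jauch-Piron representable if it has an order reflecting set of Jauch-Piron q-states. A frame is a triple $(S,T,R)$ with $S,T$ non-empty sets and $R\subseteq S\times T$. The canonical Galois connection $(P^*,G^* )$ induced by $(S,T,R)$ and the standard q-effect algebra is given by $G^*:[0,1]^T\to[0,1]^S$, $G^*(p)(s)=\bigwedge\{p(t)\mid t\in T, sRt\}$, and $P^*:[0,1]^S\to[0,1]^T$, $P^*(p)(t)=\bigvee\{p(s)\mid s\in S, sRt\}$ (with $\bigwedge\emptyset=1$, $\bigvee\emptyset=0$). *)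

theory Defs
  imports Complex_Main "HOL-Library.FuncSet" "HOL-Algebra.Congruence"
begin

text \<open>The partial sum is option-valued: \<open>ea_plus E x y = Some z\<close> means that the sum of \<open>x\<close> and
  \<open>y\<close> is defined and equals \<open>z\<close>. Values at arguments outside the carrier are irrelevant.\<close>

record 'a effect_algebra = "'a partial_object" +
  ea_plus :: "'a \<Rightarrow> 'a \<Rightarrow> 'a option"
  ea_zero :: 'a
  ea_one :: 'a

record 'a q_effect_algebra = "'a effect_algebra" +
  ea_q :: "'a \<Rightarrow> 'a"
  ea_d :: "'a \<Rightarrow> 'a"

locale effect_algebra =
  fixes E :: "('a, 'm) effect_algebra_scheme"
  assumes zero_closed: "ea_zero E \<in> carrier E"
    and one_closed: "ea_one E \<in> carrier E"
    and zero_neq_one: "ea_zero E \<noteq> ea_one E"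
    and plus_closed:
      "\<lbrakk>x \<in> carrier E; y \<in> carrier E; ea_plus E x y = Some z\<rbrakk> \<Longrightarrow> z \<in> carrier E"
    and E1: "\<lbrakk>x \<in> carrier E; y \<in> carrier E; ea_plus E x y = Some z\<rbrakk> \<Longrightarrow> ea_plus E y x = Some z"
    and E2: "\<lbrakk>x \<in> carrier E; y \<in> carrier E; z \<in> carrier E;
        ea_plus E y z = Some v; ea_plus E x v = Some w\<rbrakk>
      \<Longrightarrow> \<exists>u. ea_plus E x y = Some u \<and> ea_plus E u z = Some w"
    and E3: "x \<in> carrier E \<Longrightarrow> \<exists>!x'. x' \<in> carrier E \<and> ea_plus E x x' = Some (ea_one E)"
    and E4: "\<lbrakk>x \<in> carrier E; ea_plus E x (ea_one E) \<noteq> None\<rbrakk> \<Longrightarrow> x = ea_zero E"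

definition ea_compl :: "('a, 'm) effect_algebra_scheme \<Rightarrow> 'a \<Rightarrow> 'a" where
  "ea_compl E x = (THE x'. x' \<in> carrier E \<and> ea_plus E x x' = Some (ea_one E))"

definition ea_le :: "('a, 'm) effect_algebra_scheme \<Rightarrow> 'a \<Rightarrow> 'a \<Rightarrow> bool" where
  "ea_le E x y \<longleftrightarrow> (\<exists>z\<in>carrier E. ea_plus E x z = Some y)"

definition ea_times :: "('a, 'm) effect_algebra_scheme \<Rightarrow> 'a \<Rightarrow> 'a \<Rightarrow> 'a option" where
  "ea_times E x y =
    (if ea_le E (ea_compl E x) y
     then map_option (ea_compl E) (ea_plus E (ea_compl E x) (ea_compl E y))
     else None)"

locale q_effect_algebra = effect_algebra E
  for E :: "('a, 'm) q_effect_algebra_scheme" +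
  assumes q_closed: "x \<in> carrier E \<Longrightarrow> ea_q E x \<in> carrier E"
    and d_closed: "x \<in> carrier E \<Longrightarrow> ea_d E x \<in> carrier E"
    and Q1: "x \<in> carrier E \<Longrightarrow> ea_d E (ea_compl E x) = ea_compl E (ea_q E x)"
    and Q2: "ea_d E (ea_zero E) = ea_zero E" "ea_q E (ea_zero E) = ea_zero E"
    and Q3: "\<lbrakk>x \<in> carrier E; y \<in> carrier E; ea_le E x y\<rbrakk> \<Longrightarrow> ea_le E (ea_d E x) (ea_d E y)"
    and Q4: "\<lbrakk>x \<in> carrier E; ea_le E (ea_compl E x) x\<rbrakk> \<Longrightarrow> ea_times E x x = Some (ea_d E x)"
    and Q5: "\<lbrakk>x \<in> carrier E; y \<in> carrier E; z \<in> carrier E;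
        ea_le E z x; ea_le E z y; ea_le E (ea_compl E y) x\<rbrakk>
      \<Longrightarrow> \<exists>w. ea_times E x y = Some w \<and> ea_le E (ea_d E z) w"

definition galois_connection ::
  "('a, 'm) effect_algebra_scheme \<Rightarrow> ('b, 'n) effect_algebra_scheme
    \<Rightarrow> ('a \<Rightarrow> 'b) \<Rightarrow> ('b \<Rightarrow> 'a) \<Rightarrow> bool" where
  "galois_connection E1 E2 f g \<longleftrightarrow>
    f \<in> carrier E1 \<rightarrow> carrier E2 \<and> g \<in> carrier E2 \<rightarrow> carrier E1 \<and>
    (\<forall>a\<in>carrier E1. \<forall>b\<in>carrier E2. ea_le E2 (f a) b \<longleftrightarrow> ea_le E1 a (g b))"

definition galois_q_connection ::
  "('a, 'm) q_effect_algebra_scheme \<Rightarrow> ('b, 'n) q_effect_algebra_scheme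
    \<Rightarrow> ('a \<Rightarrow> 'b) \<Rightarrow> ('b \<Rightarrow> 'a) \<Rightarrow> bool" where
  "galois_q_connection E1 E2 f g \<longleftrightarrow>
    galois_connection E1 E2 f g \<and>
    (\<forall>x\<in>carrier E1. f (ea_q E1 x) = ea_q E2 (f x) \<and> f (ea_d E1 x) = ea_d E2 (f x)) \<and>
    (\<forall>y\<in>carrier E2. g (ea_q E2 y) = ea_q E1 (g y) \<and> g (ea_d E2 y) = ea_d E1 (g y))"

definition luk_plus :: "real \<Rightarrow> real \<Rightarrow> real" where
  "luk_plus a b = min 1 (a + b)"

definition luk_times :: "real \<Rightarrow> real \<Rightarrow> real" where
  "luk_times a b = max 0 (a + b - 1)"

definition std_qea :: "real q_effect_algebra" where
  "std_qea = \<lparr>carrier = {0..1},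
     ea_plus = (\<lambda>a b. if a + b \<le> 1 then Some (a + b) else None),
     ea_zero = 0, ea_one = 1,
     ea_q = (\<lambda>a. luk_plus a a), ea_d = (\<lambda>a. luk_times a a)\<rparr>"

definition power_qea :: "'i set \<Rightarrow> 'a q_effect_algebra \<Rightarrow> ('i \<Rightarrow> 'a) q_effect_algebra" where
  "power_qea I E = \<lparr>carrier = (\<Pi>\<^sub>E i\<in>I. carrier E),
     ea_plus = (\<lambda>p r. if \<forall>i\<in>I. ea_plus E (p i) (r i) \<noteq> None
                      then Some (\<lambda>i\<in>I. the (ea_plus E (p i) (r i))) else None),
     ea_zero = (\<lambda>i\<in>I. ea_zero E), ea_one = (\<lambda>i\<in>I. ea_one E),
     ea_q = (\<lambda>p. \<lambda>i\<in>I. ea_q E (p i)), ea_d = (\<lambda>p. \<lambda>i\<in>I. ea_d E (p i))\<rparr>"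

text \<open>States are extensional (\<open>undefined\<close> outside the carrier), so that elements of type
  \<open>'a \<Rightarrow> real\<close> satisfying the predicate correspond bijectively to maps from the carrier to
  the unit interval.\<close>

definition q_state :: "('a, 'm) q_effect_algebra_scheme \<Rightarrow> ('a \<Rightarrow> real) \<Rightarrow> bool" where
  "q_state E s \<longleftrightarrow>
    s \<in> carrier E \<rightarrow>\<^sub>E {0..1} \<and>
    s (ea_zero E) = 0 \<and> s (ea_one E) = 1 \<and>
    (\<forall>x\<in>carrier E. \<forall>y\<in>carrier E. \<forall>z. ea_plus E x y = Some z \<longrightarrow> s z = s x + s y) \<and>
    (\<forall>x\<in>carrier E. s (ea_q E x) = luk_plus (s x) (s x) \<and> s (ea_d E x) = luk_times (s x) (s x))"

definition jauch_piron_q_state :: "('a, 'm) q_effect_algebra_scheme \<Rightarrow> ('a \<Rightarrow> real) \<Rightarrow> bool" where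
  "jauch_piron_q_state E s \<longleftrightarrow>
    q_state E s \<and>
    (\<forall>x\<in>carrier E. \<forall>y\<in>carrier E. s x = 1 \<and> s y = 1 \<longrightarrow>
      (\<exists>z\<in>carrier E. ea_le E z x \<and> ea_le E z y \<and> s z = 1))"

definition order_reflecting :: "('a, 'm) effect_algebra_scheme \<Rightarrow> ('a \<Rightarrow> real) set \<Rightarrow> bool" where
  "order_reflecting E S \<longleftrightarrow>
    (\<forall>a\<in>carrier E. \<forall>b\<in>carrier E. (\<forall>s\<in>S. s a \<le> s b) \<longrightarrow> ea_le E a b)"

definition q_representable :: "('a, 'm) q_effect_algebra_scheme \<Rightarrow> bool" where
  "q_representable E \<longleftrightarrow> (\<exists>S. (\<forall>s\<in>S. q_state E s) \<and> order_reflecting E S)"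

definition q_jauch_piron_representable :: "('a, 'm) q_effect_algebra_scheme \<Rightarrow> bool" where
  "q_jauch_piron_representable E \<longleftrightarrow>
    (\<exists>S. (\<forall>s\<in>S. jauch_piron_q_state E s) \<and> order_reflecting E S)"

definition is_frame :: "'s set \<Rightarrow> 't set \<Rightarrow> ('s \<times> 't) set \<Rightarrow> bool" where
  "is_frame S T R \<longleftrightarrow> S \<noteq> {} \<and> T \<noteq> {} \<and> R \<subseteq> S \<times> T"

text \<open>Suprema and infima are taken in the complete lattice \<open>[0,1]\<close>; on the reals the values at
  the empty set have to be given explicitly.\<close>

definition unit_Inf :: "real set \<Rightarrow> real" where
  "unit_Inf A = (if A = {} then 1 else Inf A)"

definition unit_Sup :: "real set \<Rightarrow> real" where
  "unit_Sup A = (if A = {} then 0 else Sup A)"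

definition canonical_G ::
  "'s set \<Rightarrow> 't set \<Rightarrow> ('s \<times> 't) set \<Rightarrow> ('t \<Rightarrow> real) \<Rightarrow> 's \<Rightarrow> real" where
  "canonical_G S T R p = (\<lambda>s\<in>S. unit_Inf {p t | t. t \<in> T \<and> (s, t) \<in> R})"

definition canonical_P ::
  "'s set \<Rightarrow> 't set \<Rightarrow> ('s \<times> 't) set \<Rightarrow> ('s \<Rightarrow> real) \<Rightarrow> 't \<Rightarrow> real" where
  "canonical_P S T R p = (\<lambda>t\<in>T. unit_Sup {p s | s. s \<in> S \<and> (s, t) \<in> R})"

definition eval_map :: "('a \<Rightarrow> real) set \<Rightarrow> 'a \<Rightarrow> ('a \<Rightarrow> real) \<Rightarrow> real" where
  "eval_map S x = (\<lambda>s\<in>S. s x)"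

definition state_rel ::
  "('b, 'n) effect_algebra_scheme \<Rightarrow> ('b \<Rightarrow> 'a) \<Rightarrow> ('a \<Rightarrow> real) set \<Rightarrow> ('b \<Rightarrow> real) set
    \<Rightarrow> (('a \<Rightarrow> real) \<times> ('b \<Rightarrow> real)) set" where
  "state_rel E2 g S T = {(s, t) \<in> S \<times> T. \<forall>x\<in>carrier E2. s (g x) \<le> t x}"

end

theory Submission
  imports Defs "HOL-Analysis.Function_Topology"
begin

text \<open>
  The canonical maps of a frame are adjoint because both sides of the adjunction say that
  \<open>p s \<le> r t\<close> whenever \<open>s\<close> is related to \<open>t\<close>. The frame is nonempty because an algebra without
  the required states is not representable: an empty set of states reflecting the order
  would give \<open>1 \<le> 0\<close>. The substance of the theorem is that, for every
  Jauch--Piron q-state \<open>s\<close> on \<open>E1\<close>, the function \<open>s \<circ> g\<close> is the pointwise infimum of the q-states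
  on \<open>E2\<close> lying above it.

  The function \<open>s \<circ> g\<close> need not be additive, but it commutes with \<open>q\<close> and \<open>d\<close>, and this
  determines all its values by the set where it is \<open>1\<close>. Indeed, on the unit interval \<open>q\<close>
  doubles the distance from \<open>0\<close> and \<open>d\<close> the distance from \<open>1\<close>, both truncated, so any
  \<open>p < r\<close> are driven to \<open>0\<close> and \<open>1\<close> by a suitable word in \<open>q\<close> and \<open>d\<close> (\<open>word_separates\<close>). Consequently a q-state \<open>t\<close> lies
  above \<open>s \<circ> g\<close> as soon as \<open>t = 1\<close> on the set \<open>F\<close> of all \<open>y\<close> with \<open>s (g y) = 1\<close>.

  This set is closed under \<open>d\<close>, and it is directed downwards: if \<open>s (g x) = s (g y) = 1\<close>, the
  Jauch--Piron property provides \<open>z\<close> below \<open>g x\<close> and \<open>g y\<close> with \<open>s z = 1\<close>, and by adjointness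
  \<open>f z\<close> is a common lower bound of \<open>x\<close> and \<open>y\<close> in \<open>F\<close>.

  Now let \<open>s (g x) < r\<close>. A word separating these numbers turns \<open>x\<close> into an element \<open>a\<close> with
  \<open>s (g a) = 0\<close>, and then no member of \<open>F\<close> lies below \<open>q a\<close>. Order reflection in \<open>E2\<close> gives, for
  each \<open>z\<close> in \<open>F\<close>, a q-state that is large at \<open>z\<close> and at most \<open>1/2\<close> at \<open>a\<close>; the q-states form a
  compact space and \<open>F\<close> is directed, so one q-state \<open>t\<close> does this for all \<open>z\<close> at once, and
  closure of \<open>F\<close> under \<open>d\<close> improves ``large'' to \<open>t z = 1\<close> (\<open>separating_q_state\<close>). The bound
  \<open>t a \<le> 1/2\<close> forces \<open>t x < r\<close>, because the word takes \<open>r\<close> to \<open>1\<close>.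
\<close>

section \<open>The order of an effect algebra\<close>

context effect_algebra
begin

lemma plus_zero:
  assumes x: "x \<in> carrier E"
  shows "ea_plus E x (ea_zero E) = Some x"
proof -
  obtain u where u: "u \<in> carrier E" "ea_plus E (ea_one E) u = Some (ea_one E)"
    using E3[OF one_closed] by blast
  have u1: "ea_plus E u (ea_one E) = Some (ea_one E)"
    using E1[OF one_closed u(1) u(2)] .
  then have "u = ea_zero E"
    using E4[OF u(1)] by simp
  then have zero_one: "ea_plus E (ea_zero E) (ea_one E) = Some (ea_one E)"
    using u1 by simp
  obtain x' where x': "x' \<in> carrier E" "ea_plus E x x' = Some (ea_one E)"
    using E3[OF x] by blast
  obtain v where v: "ea_plus E (ea_zero E) x = Some v" "ea_plus E v x' = Some (ea_one E)"
    using E2[OF zero_closed x x'(1) x'(2) zero_one] by blast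
  have vc: "v \<in> carrier E"
    using plus_closed[OF zero_closed x v(1)] .
  \<comment> \<open>Both \<open>x\<close> and \<open>0 + x\<close> are complements of \<open>x'\<close>.\<close>
  have "v = x"
    using E3[OF x'(1)] E1[OF x x'(1) x'(2)] E1[OF vc x'(1) v(2)] x vc by blast
  then show ?thesis
    using E1[OF zero_closed x v(1)] by simp
qed

lemma le_refl: "x \<in> carrier E \<Longrightarrow> ea_le E x x"
  unfolding ea_le_def using plus_zero zero_closed by blast

lemma le_one: "x \<in> carrier E \<Longrightarrow> ea_le E x (ea_one E)"
  unfolding ea_le_def using E3 by blast

lemma le_trans:
  assumes x: "x \<in> carrier E" and y: "y \<in> carrier E" and z: "z \<in> carrier E"
    and xy: "ea_le E x y" and yz: "ea_le E y z"
  shows "ea_le E x z"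
proof -
  obtain u where u: "u \<in> carrier E" "ea_plus E x u = Some y"
    using xy unfolding ea_le_def by blast
  obtain v where v: "v \<in> carrier E" "ea_plus E y v = Some z"
    using yz unfolding ea_le_def by blast
  obtain w where w: "ea_plus E v u = Some w" "ea_plus E w x = Some z"
    using E2[OF v(1) u(1) x E1[OF x u(1) u(2)] E1[OF y v(1) v(2)]] by blast
  have wc: "w \<in> carrier E"
    using plus_closed[OF v(1) u(1) w(1)] .
  show ?thesis
    unfolding ea_le_def using wc E1[OF wc x w(2)] by blast
qed

lemma not_one_le_zero: "\<not> ea_le E (ea_one E) (ea_zero E)"
proof
  assume "ea_le E (ea_one E) (ea_zero E)"
  then obtain z where z: "z \<in> carrier E" "ea_plus E (ea_one E) z = Some (ea_zero E)"
    unfolding ea_le_def by blast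
  have "z = ea_zero E"
    using E4[OF z(1)] E1[OF one_closed z(1) z(2)] by simp
  then show False
    using z(2) plus_zero[OF one_closed] zero_neq_one by simp
qed

lemma order_reflecting_nonempty: "order_reflecting E S \<Longrightarrow> S \<noteq> {}"
  using not_one_le_zero zero_closed one_closed unfolding order_reflecting_def by blast

lemma lower_bound_of_finite_subset:
  assumes "finite B" "B \<subseteq> F" "F \<subseteq> carrier E" "F \<noteq> {}"
    and directed: "\<And>x y. x \<in> F \<Longrightarrow> y \<in> F \<Longrightarrow> \<exists>z\<in>F. ea_le E z x \<and> ea_le E z y"
  shows "\<exists>z\<in>F. \<forall>y\<in>B. ea_le E z y"
  using assms(1,2)
proof (induction B rule: finite_induct)
  case empty
  then show ?case using \<open>F \<noteq> {}\<close> by blast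
next
  case (insert b B)
  then obtain z where z: "z \<in> F" "\<forall>y\<in>B. ea_le E z y" by blast
  obtain z' where z': "z' \<in> F" "ea_le E z' b" "ea_le E z' z"
    using directed[of b z] z(1) insert.prems by blast
  have "ea_le E z' y" if "y \<in> B" for y
  proof (rule le_trans[OF _ _ _ z'(3)])
    show "ea_le E z y" using z(2) that by blast
  qed (use z(1) z'(1) that insert.prems \<open>F \<subseteq> carrier E\<close> in auto)
  then show ?case using z'(1,2) by blast
qed

end

section \<open>Separating real numbers by iterated doubling\<close>

text \<open>A word is executed from its first letter to its last; \<open>True\<close> stands for \<open>q\<close> and
  \<open>False\<close> for \<open>d\<close>.\<close>

definition apply_word :: "('a \<Rightarrow> 'a) \<Rightarrow> ('a \<Rightarrow> 'a) \<Rightarrow> bool list \<Rightarrow> 'a \<Rightarrow> 'a" where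
  "apply_word q d w = fold (\<lambda>b. if b then q else d) w"

lemma apply_word_Nil [simp]: "apply_word q d [] x = x"
  and apply_word_Cons [simp]:
    "apply_word q d (b # w) x = apply_word q d w (if b then q x else d x)"
  by (simp_all add: apply_word_def)

abbreviation luk_word :: "bool list \<Rightarrow> real \<Rightarrow> real" where
  "luk_word \<equiv> apply_word (\<lambda>a. luk_plus a a) (\<lambda>a. luk_times a a)"

lemma luk_word_mono: "a \<le> b \<Longrightarrow> luk_word w a \<le> luk_word w b"
  by (induction w arbitrary: a b) (auto simp: luk_plus_def luk_times_def)

lemma luk_word_replicate_times:
  assumes "0 \<le> p" "1 \<le> 2 ^ n * (1 - p)"
  shows "luk_word (replicate n False) p = 0 \<and> luk_word (replicate n False) 1 = 1"
  using assms
proof (induction n arbitrary: p)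
  case 0
  then show ?case by simp
next
  case (Suc n)
  \<comment> \<open>Truncation at \<open>0\<close> can only bring the distance to \<open>1\<close> down to \<open>1\<close> itself.\<close>
  have "1 \<le> 2 ^ n * (1 - luk_times p p)"
    using Suc.prems one_le_power[of "2::real" n]
    by (auto simp: luk_times_def max_def algebra_simps)
  moreover have "0 \<le> luk_times p p" "luk_times 1 1 = (1::real)"
    by (auto simp: luk_times_def)
  ultimately show ?case using Suc.IH[of "luk_times p p"] by simp
qed

lemma exists_power_of_two_ge:
  fixes e :: real
  assumes "0 < e"
  shows "\<exists>n. 1 \<le> 2 ^ n * e"
proof -
  obtain n where "1 / e < 2 ^ n"
    using real_arch_pow[of 2 "1 / e"] by auto
  then show ?thesis using assms by (intro exI[of _ n]) (simp add: field_simps)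
qed

text \<open>As long as \<open>p\<close> and \<open>r\<close> lie in the same half of the interval, one letter doubles their
  distance. Once \<open>1/2\<close> lies between them, \<open>q\<close> sends \<open>r\<close> to \<open>1\<close>, a fixed point of \<open>d\<close>, while \<open>p\<close>
  stays below \<open>1\<close> and iterating \<open>d\<close> takes it to \<open>0\<close>.\<close>

lemma word_separates:
  assumes "0 \<le> p" "p < r" "r \<le> 1"
  shows "\<exists>w. luk_word w p = 0 \<and> luk_word w r = 1"
proof -
  have "\<exists>w. luk_word w p = 0 \<and> luk_word w r = 1"
    if "0 \<le> p" "p < r" "r \<le> 1" "1 \<le> 2 ^ n * (r - p)" for n p r
    using that
  proof (induction n arbitrary: p r)
    case 0
    then have "p = 0" "r = 1" by auto
    then show ?case by (intro exI[of _ "[]"]) simp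
  next
    case (Suc n)
    consider "r \<le> 1/2" | "1/2 \<le> p" | "p < 1/2" "1/2 < r" by linarith
    then show ?case
    proof cases
      case 1
      then have "luk_plus p p = 2 * p" "luk_plus r r = 2 * r"
        using Suc.prems by (auto simp: luk_plus_def)
      moreover obtain w where "luk_word w (2 * p) = 0 \<and> luk_word w (2 * r) = 1"
        using Suc.IH[of "2 * p" "2 * r"] 1 Suc.prems by (auto simp: algebra_simps)
      ultimately show ?thesis by (intro exI[of _ "True # w"]) simp
    next
      case 2
      then have "luk_times p p = 2 * p - 1" "luk_times r r = 2 * r - 1"
        using Suc.prems by (auto simp: luk_times_def)
      moreover obtain w where "luk_word w (2 * p - 1) = 0 \<and> luk_word w (2 * r - 1) = 1"
        using Suc.IH[of "2 * p - 1" "2 * r - 1"] 2 Suc.prems by (auto simp: algebra_simps)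
      ultimately show ?thesis by (intro exI[of _ "False # w"]) simp
    next
      case 3
      then have "luk_plus p p = 2 * p" "luk_plus r r = 1"
        by (auto simp: luk_plus_def)
      moreover obtain m where "1 \<le> 2 ^ m * (1 - 2 * p)"
        using exists_power_of_two_ge[of "1 - 2 * p"] 3 by auto
      ultimately show ?thesis
        using luk_word_replicate_times[of "2 * p" m] Suc.prems
        by (intro exI[of _ "True # replicate m False"]) simp
    qed
  qed
  then show ?thesis
    using assms exists_power_of_two_ge[of "r - p"] by fastforce
qed

section \<open>States and words\<close>

lemma q_state_bounds: "q_state E t \<Longrightarrow> x \<in> carrier E \<Longrightarrow> 0 \<le> t x \<and> t x \<le> 1"
  unfolding q_state_def by (auto simp: PiE_iff)

lemma q_state_mono:
  assumes t: "q_state E t" and "x \<in> carrier E" "ea_le E x y"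
  shows "t x \<le> t y"
proof -
  obtain z where z: "z \<in> carrier E" "ea_plus E x z = Some y"
    using assms unfolding ea_le_def by blast
  then have "t y = t x + t z"
    using t assms(2) unfolding q_state_def by blast
  then show ?thesis using q_state_bounds[OF t z(1)] by simp
qed

context q_effect_algebra
begin

abbreviation word :: "bool list \<Rightarrow> 'a \<Rightarrow> 'a" where
  "word \<equiv> apply_word (ea_q E) (ea_d E)"

lemma word_closed: "x \<in> carrier E \<Longrightarrow> word w x \<in> carrier E"
  by (induction w arbitrary: x) (auto simp: q_closed d_closed)

lemma word_hom:
  assumes "\<And>y. y \<in> carrier E \<Longrightarrow> h (ea_q E y) = luk_plus (h y) (h y)"
    and "\<And>y. y \<in> carrier E \<Longrightarrow> h (ea_d E y) = luk_times (h y) (h y)"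
    and "x \<in> carrier E"
  shows "h (word w x) = luk_word w (h x)"
  using assms(3) by (induction w arbitrary: x) (auto simp: q_closed d_closed assms(1,2))

lemma q_state_word:
  assumes "q_state E t" "x \<in> carrier E"
  shows "t (word w x) = luk_word w (t x)"
  using assms by (intro word_hom) (auto simp: q_state_def)

section \<open>Compactness of the space of q-states\<close>

text \<open>A q-state is defined by closed conditions, each on finitely many of its values, so
  Tychonoff's theorem applies. Outside the carrier the state has the single value
  \<open>undefined\<close>, hence a compact range there as well.\<close>

lemma compact_q_states: "compact {t. q_state E t}"
proof -
  let ?B = "\<lambda>i. if i \<in> carrier E then {0..1::real} else {undefined}"
  have "compact (PiE UNIV ?B)"
  proof -
    have "compactin (product_topology (\<lambda>i. euclidean) UNIV) (PiE UNIV ?B)"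
      by (subst compactin_PiE) (auto simp: compactin_euclidean_iff)
    then show ?thesis
      by (simp add: euclidean_product_topology compactin_euclidean_iff)
  qed
  moreover have "PiE UNIV ?B = carrier E \<rightarrow>\<^sub>E {0..1}"
    by (auto simp: PiE_iff extensional_def split: if_splits)
  ultimately have comp: "compact (carrier E \<rightarrow>\<^sub>E {0..1::real})"
    by simp
  have coord: "continuous_on UNIV (\<lambda>t::'a \<Rightarrow> real. t x)" for x
    by (rule continuous_on_product_coordinates)
  have "closed {t::'a \<Rightarrow> real. t (ea_zero E) = 0 \<and> t (ea_one E) = 1 \<and>
      (\<forall>x\<in>carrier E. \<forall>y\<in>carrier E. \<forall>z. ea_plus E x y = Some z \<longrightarrow> t z = t x + t y) \<and>
      (\<forall>x\<in>carrier E. t (ea_q E x) = luk_plus (t x) (t x) \<and> t (ea_d E x) = luk_times (t x) (t x))}"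
    unfolding Ball_def luk_plus_def luk_times_def
    by (intro closed_Collect_conj closed_Collect_all closed_Collect_imp closed_Collect_eq
        open_Collect_const continuous_intros coord)
  from compact_Int_closed[OF comp this] show ?thesis
    unfolding q_state_def Collect_conj_eq by (simp add: Int_assoc Collect_conj_eq)
qed

text \<open>A state that is positive at \<open>d z\<close> exceeds \<open>1/2\<close> at \<open>z\<close>, and one below \<open>1\<close> at \<open>q a\<close> is below
  \<open>1/2\<close> at \<open>a\<close>; so a state witnessing that \<open>d z\<close> is not below \<open>q a\<close> satisfies two inequalities
  that survive a limit. In the limit it is at least \<open>1/2\<close> on all iterates of \<open>d\<close> at \<open>z\<close>, which
  forces the value \<open>1\<close> at \<open>z\<close>.\<close>

lemma separating_q_state:
  assumes rep: "q_representable E" and a: "a \<in> carrier E"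
    and F: "F \<subseteq> carrier E" "F \<noteq> {}"
    and directed: "\<And>x y. x \<in> F \<Longrightarrow> y \<in> F \<Longrightarrow> \<exists>z\<in>F. ea_le E z x \<and> ea_le E z y"
    and F_d: "\<And>x. x \<in> F \<Longrightarrow> ea_d E x \<in> F"
    and not_below: "\<And>z. z \<in> F \<Longrightarrow> \<not> ea_le E z (ea_q E a)"
  shows "\<exists>t. q_state E t \<and> (\<forall>z\<in>F. t z = 1) \<and> t a \<le> 1/2"
proof -
  obtain S where S: "\<forall>t\<in>S. q_state E t" "order_reflecting E S"
    using rep unfolding q_representable_def by blast
  let ?C = "\<lambda>z. {t::'a \<Rightarrow> real. 1/2 \<le> t z}"
  have coord: "continuous_on UNIV (\<lambda>t::'a \<Rightarrow> real. t x)" for x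
    by (rule continuous_on_product_coordinates)
  have "closed {t::'a \<Rightarrow> real. t a \<le> 1/2}"
    by (intro closed_Collect_le continuous_intros coord)
  then have comp: "compact ({t. q_state E t} \<inter> {t. t a \<le> 1/2})"
    by (rule compact_Int_closed[OF compact_q_states])
  have one_state: "\<exists>t. q_state E t \<and> t a \<le> 1/2 \<and> 1/2 \<le> t z" if "z \<in> F" for z
  proof -
    have "\<not> ea_le E (ea_d E z) (ea_q E a)"
      using not_below F_d that by blast
    moreover have zc: "z \<in> carrier E" "ea_d E z \<in> carrier E" "ea_q E a \<in> carrier E"
      using F(1) that a d_closed q_closed by auto
    ultimately have "\<not> (\<forall>t\<in>S. t (ea_d E z) \<le> t (ea_q E a))"
      using S(2) unfolding order_reflecting_def by blast
    then obtain t where t: "t \<in> S" "t (ea_q E a) < t (ea_d E z)"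
      by (auto simp: not_le)
    then have st: "q_state E t" using S(1) by blast
    have "t (ea_q E a) = luk_plus (t a) (t a)" "t (ea_d E z) = luk_times (t z) (t z)"
      using st a zc(1) unfolding q_state_def by blast+
    then have "luk_plus (t a) (t a) < luk_times (t z) (t z)"
      using t(2) by simp
    moreover have "0 \<le> t a" "t z \<le> 1"
      using q_state_bounds[OF st] a F(1) that by auto
    ultimately have "t a \<le> 1/2" "1/2 \<le> t z"
      by (auto simp: luk_plus_def luk_times_def min_def max_def split: if_splits)
    then show ?thesis using st by blast
  qed
  have "({t. q_state E t} \<inter> {t. t a \<le> 1/2}) \<inter> \<Inter>(?C ` F) \<noteq> {}"
  proof (rule compact_imp_fip[OF comp])
    show "closed K" if "K \<in> ?C ` F" for K
      using that by (auto intro!: closed_Collect_le continuous_intros coord)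
  next
    fix \<K> assume "finite \<K>" "\<K> \<subseteq> ?C ` F"
    then obtain B where B: "finite B" "B \<subseteq> F" "\<K> = ?C ` B"
      using finite_subset_image by metis
    obtain z where z: "z \<in> F" "\<forall>y\<in>B. ea_le E z y"
      using lower_bound_of_finite_subset[OF B(1,2) F directed] by blast
    obtain t where t: "q_state E t" "t a \<le> 1/2" "1/2 \<le> t z"
      using one_state[OF z(1)] by blast
    have "1/2 \<le> t y" if "y \<in> B" for y
    proof -
      have "t z \<le> t y"
        using q_state_mono[OF t(1)] z that F(1) by blast
      then show ?thesis using t(3) by simp
    qed
    then show "({t. q_state E t} \<inter> {t. t a \<le> 1/2}) \<inter> \<Inter>\<K> \<noteq> {}"
      using t B(3) by blast
  qed
  then obtain t where t: "q_state E t" "t a \<le> 1/2" "\<And>z. z \<in> F \<Longrightarrow> 1/2 \<le> t z"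
    by blast
  have "t z = 1" if z: "z \<in> F" for z
  proof (rule ccontr)
    assume "t z \<noteq> 1"
    then have "0 \<le> t z" "t z < 1"
      using q_state_bounds[OF t(1), of z] z F(1) by fastforce+
    then obtain n where "luk_word (replicate n False) (t z) = 0"
      using exists_power_of_two_ge[of "1 - t z"] luk_word_replicate_times by fastforce
    then have "t (word (replicate n False) z) = 0"
      using q_state_word[OF t(1)] z F(1) by auto
    moreover have "word (replicate n False) z \<in> F"
      using z by (induction n arbitrary: z) (auto simp: F_d)
    ultimately show False using t(3) by fastforce
  qed
  then show ?thesis using t by blast
qed

end

section \<open>The Galois connection of a frame\<close>

lemma power_std_carrier: "carrier (power_qea I std_qea) = (I \<rightarrow>\<^sub>E {0..1})"
  by (simp add: power_qea_def std_qea_def)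

lemma power_std_le_iff:
  assumes "p \<in> I \<rightarrow>\<^sub>E {0..1}" "r \<in> I \<rightarrow>\<^sub>E {0..1}"
  shows "ea_le (power_qea I std_qea) p r \<longleftrightarrow> (\<forall>i\<in>I. p i \<le> r i)"
proof
  assume "ea_le (power_qea I std_qea) p r"
  then obtain z where z: "z \<in> I \<rightarrow>\<^sub>E {0..1}" "ea_plus (power_qea I std_qea) p z = Some r"
    unfolding ea_le_def power_std_carrier by blast
  then have "\<forall>i\<in>I. r i = p i + z i"
    by (auto simp: power_qea_def std_qea_def split: if_splits)
  moreover have "\<forall>i\<in>I. 0 \<le> z i" using z(1) by (auto simp: PiE_iff)
  ultimately show "\<forall>i\<in>I. p i \<le> r i" by simp
next
  assume le: "\<forall>i\<in>I. p i \<le> r i"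
  let ?z = "\<lambda>i\<in>I. r i - p i"
  have bounds: "0 \<le> p i" "r i \<le> 1" if "i \<in> I" for i
    using assms that by (auto simp: PiE_iff)
  have "?z \<in> I \<rightarrow>\<^sub>E {0..1}"
    using le bounds by (fastforce simp: PiE_iff)
  moreover have "ea_plus (power_qea I std_qea) p ?z = Some r"
    using assms(2) bounds by (auto simp: power_qea_def std_qea_def PiE_iff extensional_def)
  ultimately show "ea_le (power_qea I std_qea) p r"
    unfolding ea_le_def power_std_carrier by blast
qed

lemma le_unit_Inf_iff:
  assumes "A \<subseteq> {0..1}" "c \<le> 1"
  shows "c \<le> unit_Inf A \<longleftrightarrow> (\<forall>a\<in>A. c \<le> a)"
proof (cases "A = {}")
  case False
  moreover have "bdd_below A" using assms(1) by (meson bdd_below_Icc bdd_below_mono)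
  ultimately show ?thesis by (simp add: unit_Inf_def le_cInf_iff)
qed (simp add: unit_Inf_def assms)

lemma unit_Sup_le_iff:
  assumes "A \<subseteq> {0..1}" "0 \<le> c"
  shows "unit_Sup A \<le> c \<longleftrightarrow> (\<forall>a\<in>A. a \<le> c)"
proof (cases "A = {}")
  case False
  moreover have "bdd_above A" using assms(1) by (meson bdd_above_Icc bdd_above_mono)
  ultimately show ?thesis by (simp add: unit_Sup_def cSup_le_iff)
qed (simp add: unit_Sup_def assms)

lemma unit_Inf_bounds:
  assumes "A \<subseteq> {0..1}"
  shows "0 \<le> unit_Inf A \<and> unit_Inf A \<le> 1"
proof (cases "A = {}")
  case False
  then obtain a where "a \<in> A" by blast
  then have "unit_Inf A \<le> a" "a \<le> 1"
    using assms False by (auto simp: unit_Inf_def intro!: cInf_lower bdd_below_mono[OF bdd_below_Icc])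
  then show ?thesis using le_unit_Inf_iff[OF assms, of 0] assms by auto
qed (simp add: unit_Inf_def)

lemma unit_Sup_bounds:
  assumes "A \<subseteq> {0..1}"
  shows "0 \<le> unit_Sup A \<and> unit_Sup A \<le> 1"
proof (cases "A = {}")
  case False
  then obtain a where "a \<in> A" by blast
  then have "a \<le> unit_Sup A" "0 \<le> a"
    using assms False by (auto simp: unit_Sup_def intro!: cSup_upper bdd_above_mono[OF bdd_above_Icc])
  then show ?thesis using unit_Sup_le_iff[OF assms, of 1] assms by auto
qed (simp add: unit_Sup_def)

lemma canonical_galois_connection:
  "galois_connection (power_qea S std_qea) (power_qea T std_qea)
     (canonical_P S T R) (canonical_G S T R)"
proof -
  have valP: "{p s | s. s \<in> S \<and> (s, t) \<in> R} \<subseteq> {0..1}"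
    if "p \<in> S \<rightarrow>\<^sub>E {0..1}" for p :: "'a \<Rightarrow> real" and t
    using that by (auto simp: PiE_iff)
  have valG: "{r t | t. t \<in> T \<and> (s, t) \<in> R} \<subseteq> {0..1}"
    if "r \<in> T \<rightarrow>\<^sub>E {0..1}" for r :: "'b \<Rightarrow> real" and s
    using that by (auto simp: PiE_iff)
  have P: "canonical_P S T R p \<in> T \<rightarrow>\<^sub>E {0..1}" if "p \<in> S \<rightarrow>\<^sub>E {0..1}" for p
    using unit_Sup_bounds[OF valP[OF that]] by (auto simp: canonical_P_def)
  have G: "canonical_G S T R r \<in> S \<rightarrow>\<^sub>E {0..1}" if "r \<in> T \<rightarrow>\<^sub>E {0..1}" for r
    using unit_Inf_bounds[OF valG[OF that]] by (auto simp: canonical_G_def)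
  have "ea_le (power_qea T std_qea) (canonical_P S T R p) r \<longleftrightarrow>
      ea_le (power_qea S std_qea) p (canonical_G S T R r)"
    if p: "p \<in> S \<rightarrow>\<^sub>E {0..1}" and r: "r \<in> T \<rightarrow>\<^sub>E {0..1}" for p r
  proof -
    have "(\<forall>t\<in>T. canonical_P S T R p t \<le> r t) \<longleftrightarrow>
        (\<forall>t\<in>T. \<forall>s\<in>S. (s, t) \<in> R \<longrightarrow> p s \<le> r t)"
      using r unit_Sup_le_iff[OF valP[OF p]] by (fastforce simp: canonical_P_def PiE_iff)
    also have "\<dots> \<longleftrightarrow> (\<forall>s\<in>S. \<forall>t\<in>T. (s, t) \<in> R \<longrightarrow> p s \<le> r t)"
      by blast
    also have "\<dots> \<longleftrightarrow> (\<forall>s\<in>S. p s \<le> canonical_G S T R r s)"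
      using p le_unit_Inf_iff[OF valG[OF r]] by (fastforce simp: canonical_G_def PiE_iff)
    finally show ?thesis
      using power_std_le_iff[OF P[OF p] r] power_std_le_iff[OF p G[OF r]] by simp
  qed
  then show ?thesis
    unfolding galois_connection_def power_std_carrier using P G by auto
qed

section \<open>Pulling a Jauch--Piron state back along the right adjoint\<close>

text \<open>The q-states above \<open>s \<circ> g\<close> have values that come arbitrarily close to \<open>s (g x)\<close>: the word separating
  \<open>s (g x)\<close> from \<open>r\<close> yields the element to which \<open>separating_q_state\<close> is applied, with the
  directed set where \<open>s \<circ> g\<close> is \<open>1\<close>.\<close>

lemma q_state_above_pullback:
  assumes E1: "q_effect_algebra E1" and E2: "q_effect_algebra E2"
    and gal: "galois_q_connection E1 E2 f g"
    and rep: "q_representable E2"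
    and s: "jauch_piron_q_state E1 s"
    and x: "x \<in> carrier E2" and r: "s (g x) < r" "r \<le> 1"
  shows "\<exists>t. q_state E2 t \<and> (\<forall>y\<in>carrier E2. s (g y) \<le> t y) \<and> t x < r"
proof -
  interpret A: q_effect_algebra E1 by (rule E1)
  interpret B: q_effect_algebra E2 by (rule E2)
  have sq: "q_state E1 s" using s unfolding jauch_piron_q_state_def by blast
  have fc: "f a \<in> carrier E2" if "a \<in> carrier E1" for a
    using gal that unfolding galois_q_connection_def galois_connection_def by auto
  have gc: "g b \<in> carrier E1" if "b \<in> carrier E2" for b
    using gal that unfolding galois_q_connection_def galois_connection_def by auto
  have adj: "ea_le E2 (f a) b \<longleftrightarrow> ea_le E1 a (g b)" if "a \<in> carrier E1" "b \<in> carrier E2" for a b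
    using gal that unfolding galois_q_connection_def galois_connection_def by auto
  have g_mono: "ea_le E1 (g b) (g c)" if "b \<in> carrier E2" "c \<in> carrier E2" "ea_le E2 b c" for b c
    using that adj[of "g b" b] adj[of "g b" c] A.le_refl[of "g b"] B.le_trans[of "f (g b)" b c]
      fc gc by blast
  have h_q: "s (g (ea_q E2 y)) = luk_plus (s (g y)) (s (g y))"
    and h_d: "s (g (ea_d E2 y)) = luk_times (s (g y)) (s (g y))" if "y \<in> carrier E2" for y
    using gal sq gc that unfolding galois_q_connection_def q_state_def by auto
  have h_word: "s (g (B.word w y)) = luk_word w (s (g y))" if "y \<in> carrier E2" for w y
    using B.word_hom[where h = "\<lambda>y. s (g y)"] h_q h_d that by blast
  have h_bounds: "0 \<le> s (g y)" "s (g y) \<le> 1" if "y \<in> carrier E2" for y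
    using q_state_bounds[OF sq gc[OF that]] by auto

  define F where "F = {y \<in> carrier E2. s (g y) = 1}"
  have f_in_F: "f z \<in> F" if z: "z \<in> carrier E1" "s z = 1" for z
  proof -
    have "ea_le E1 z (g (f z))"
      using adj[of z "f z"] fc[OF z(1)] z(1) B.le_refl by blast
    then have "1 \<le> s (g (f z))"
      using q_state_mono[OF sq z(1)] z(2) by fastforce
    then show ?thesis
      unfolding F_def using h_bounds[OF fc[OF z(1)]] fc[OF z(1)] by auto
  qed
  have F_sub: "F \<subseteq> carrier E2" unfolding F_def by blast
  have F_ne: "F \<noteq> {}"
    using f_in_F[OF A.one_closed] sq unfolding q_state_def by blast
  have F_d: "ea_d E2 y \<in> F" if "y \<in> F" for y
    using that h_d[of y] B.d_closed[of y] by (auto simp: F_def luk_times_def)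
  have F_dir: "\<exists>z\<in>F. ea_le E2 z y \<and> ea_le E2 z y'" if yF: "y \<in> F" "y' \<in> F" for y y'
  proof -
    have y: "y \<in> carrier E2" "y' \<in> carrier E2" "s (g y) = 1" "s (g y') = 1"
      using yF unfolding F_def by auto
    obtain z where "z \<in> carrier E1" "ea_le E1 z (g y)" "ea_le E1 z (g y')" "s z = 1"
      using s gc y unfolding jauch_piron_q_state_def by blast
    then show ?thesis
      using adj[of z] f_in_F y by blast
  qed

  obtain w where w: "luk_word w (s (g x)) = 0" "luk_word w r = 1"
    using word_separates[of "s (g x)" r] h_bounds[OF x] r by blast
  define a where "a = B.word w x"
  have a: "a \<in> carrier E2" "s (g a) = 0"
    unfolding a_def using B.word_closed h_word w x by auto
  have "\<not> ea_le E2 z (ea_q E2 a)" if z: "z \<in> F" for z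
  proof
    assume le: "ea_le E2 z (ea_q E2 a)"
    have "s (g z) \<le> s (g (ea_q E2 a))"
      using q_state_mono[OF sq gc g_mono[OF _ _ le]] z B.q_closed[OF a(1)] by (auto simp: F_def)
    then show False
      using z a h_q[OF a(1)] by (auto simp: F_def luk_plus_def)
  qed
  from B.separating_q_state[OF rep a(1) F_sub F_ne F_dir F_d this]
  obtain t where t: "q_state E2 t" "\<And>z. z \<in> F \<Longrightarrow> t z = 1" "t a \<le> 1/2"
    by blast
  have "s (g y) \<le> t y" if y: "y \<in> carrier E2" for y
  proof (rule ccontr)
    assume "\<not> s (g y) \<le> t y"
    then obtain v where v: "luk_word v (t y) = 0" "luk_word v (s (g y)) = 1"
      using word_separates[of "t y" "s (g y)"] h_bounds[OF y] q_state_bounds[OF t(1) y] by auto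
    then have "B.word v y \<in> F"
      unfolding F_def using h_word B.word_closed y by auto
    then have "t (B.word v y) = 1" by (rule t(2))
    then show False
      using B.q_state_word[OF t(1) y] v(1) by simp
  qed
  moreover have "t x < r"
  proof (rule ccontr)
    assume "\<not> t x < r"
    then have "1 \<le> luk_word w (t x)"
      using luk_word_mono[of r "t x" w] w(2) by simp
    then show False
      using t(3) B.q_state_word[OF t(1) x] by (simp add: a_def)
  qed
  ultimately show ?thesis using t(1) by blast
qed

theorem theorem3:
  fixes E1 :: "'a q_effect_algebra" and E2 :: "'b q_effect_algebra"
    and f :: "'a \<Rightarrow> 'b" and g :: "'b \<Rightarrow> 'a"
    and S :: "('a \<Rightarrow> real) set" and T :: "('b \<Rightarrow> real) set"
    and R :: "(('a \<Rightarrow> real) \<times> ('b \<Rightarrow> real)) set"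
  assumes "q_effect_algebra E1" and "q_effect_algebra E2"
    and "galois_q_connection E1 E2 f g"
    and "q_representable E2"
    and "q_jauch_piron_representable E1"
    and "T = {t. q_state E2 t}"
    and "S = {s. jauch_piron_q_state E1 s}"
    and "R = state_rel E2 g S T"
  shows "is_frame S T R \<and>
    galois_connection (power_qea S std_qea) (power_qea T std_qea)
      (canonical_P S T R) (canonical_G S T R) \<and>
    (\<forall>x\<in>carrier E2. eval_map S (g x) = canonical_G S T R (eval_map T x))"
proof -
  interpret A: q_effect_algebra E1 by fact
  interpret B: q_effect_algebra E2 by fact
  have "S \<noteq> {}"
    using assms(5,7) A.order_reflecting_nonempty
    unfolding q_jauch_piron_representable_def by blast
  moreover have "T \<noteq> {}"
    using assms(4,6) B.order_reflecting_nonempty unfolding q_representable_def by blast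
  ultimately have frame: "is_frame S T R"
    unfolding is_frame_def assms(8) state_rel_def by blast
  have "s (g x) = unit_Inf {eval_map T x t | t. t \<in> T \<and> (s, t) \<in> R}" (is "_ = unit_Inf ?V")
    if x: "x \<in> carrier E2" and sS: "s \<in> S" for x s
  proof (rule antisym)
    have s: "jauch_piron_q_state E1 s" "q_state E1 s"
      using sS assms(7) unfolding jauch_piron_q_state_def by auto
    have "g x \<in> carrier E1"
      using assms(3) x unfolding galois_q_connection_def galois_connection_def by auto
    then have s1: "s (g x) \<le> 1"
      using q_state_bounds[OF s(2)] by blast
    have V: "?V \<subseteq> {0..1}"
      using q_state_bounds[OF _ x] assms(6) by (auto simp: eval_map_def)
    have "\<forall>v\<in>?V. s (g x) \<le> v"
      using x assms(8) by (auto simp: eval_map_def state_rel_def)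
    then show "s (g x) \<le> unit_Inf ?V"
      using le_unit_Inf_iff[OF V s1] by blast
    show "unit_Inf ?V \<le> s (g x)"
    proof (rule ccontr)
      assume "\<not> unit_Inf ?V \<le> s (g x)"
      then have less: "s (g x) < unit_Inf ?V" by simp
      have le1: "unit_Inf ?V \<le> 1" using unit_Inf_bounds[OF V] by blast
      obtain t where t: "q_state E2 t" "\<forall>y\<in>carrier E2. s (g y) \<le> t y" "t x < unit_Inf ?V"
        using q_state_above_pullback[OF assms(1-4) s(1) x less le1] by blast
      then have "t x \<in> ?V"
        using sS assms(6,8) by (auto simp: eval_map_def state_rel_def intro!: exI[of _ t])
      then have "unit_Inf ?V \<le> t x"
        using le_unit_Inf_iff[OF V le1] by blast
      then show False using t(3) by simp
    qed
  qed
  then have "\<forall>x\<in>carrier E2. eval_map S (g x) = canonical_G S T R (eval_map T x)"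
    by (auto simp: eval_map_def[of S] canonical_G_def)
  then show ?thesis
    using frame canonical_galois_connection by blast
qed

end
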